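(* Suppose $\kappa$ is a strongly inaccessible cardinal which is not Mahlo and $\diamondsuit_\kappa$ holds. Let $b\in\mathcal{R}^+_\kappa$. Then $$\mathfrak{d}_\kappa(\le^* )\ \le\ \mathfrak{d}^{b,\mathrm{id}^+}_\kappa(\not\ni^\infty)\ \le\ \mathfrak{d}^{b,b}_\kappa(\not\ni^\infty)\ =\ \mathfrak{d}^b_\kappa(\le^* ).$$
   Context: $\mathcal{R}^+_\kappa$ is the set of all strictly increasing $b\in{}^\kappa\kappa$ such that each $b(\alpha)\geq 3$ is an infinite regular cardinal and $\alpha<b(\alpha)$ for every $\alpha<\kappa$. $\mathrm{id}^+$ is the function $\mathrm{id}^+(\alpha)=|\alpha|^+$, so slaloms of width $<\mathrm{id}^+$ satisfy $|\varphi(\alpha)|\le|\alpha|$. For a function $h$ on $\kappa$ with cardinal values, $h\le b$, put $\mathrm{Loc}^{b,h}_\kappa=\prod_{\alpha<\kappa}[b(\alpha)]^{<h(\alpha)}$. For $\varphi\in\mathrm{Loc}^{b,h}_\kappa$ and $f\in\prod_{\alpha<\kappa}b(\alpha)$, $\varphi\not\ni^\infty f$ means that there is $\alpha<\kappa$ with $f(\beta)\notin\varphi(\beta)$ for all $\beta\ge\alpha$; and $\mathfrak{d}^{b,h}_\kappa(\not\ni^\infty)$ is the least size of $\mathcal G\subseteq\prod_{\alpha<\kappa}b(\alpha)$ such that for every $\varphi\in\mathrm{Loc}^{b,h}_\kappa$ there is $f\in\mathcal G$ with $\varphi\not\ni^\infty f$. $f\le^* g$ means $f(\beta)\le g(\beta)$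 for all $\beta$ from some point $\alpha<\kappa$ on. $\mathfrak{d}_\kappa(\le^* )$ is the least size of $\mathcal G\subseteq{}^\kappa\kappa$ such that every $f\in{}^\kappa\kappa$ is $\le^*$ some $g\in\mathcal G$; $\mathfrak{d}^b_\kappa(\le^* )$ is the same with ${}^\kappa\kappa$ replaced in both places by $\prod_{\alpha<\kappa}b(\alpha)$. *)

theory Defs
  imports Main "HOL-Library.FuncSet"
begin

unbundle cardinal_syntax

text \<open>
  The cardinal \<open>\<kappa>\<close> is the whole of a type \<open>'k\<close> of class \<open>wellorder\<close>: ordinals below \<open>\<kappa>\<close> are the
  elements of \<open>'k\<close>, an ordinal \<open>\<alpha> < \<kappa>\<close> is identified with the set \<open>{..<\<alpha>}\<close> of its predecessors,
  and \<open>\<kappa>\<close> itself with \<open>UNIV\<close>. Sizes of arbitrary sets are the cardinals \<open>|A|\<close> of the library,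
  compared with \<open>\<le>o\<close>, \<open><o\<close>, \<open>=o\<close>.
\<close>

definition ordrel :: "'k::wellorder set \<Rightarrow> 'k rel" where
  "ordrel S = {(x, y). x \<in> S \<and> y \<in> S \<and> x \<le> y}"

text \<open>
  \<open>S\<close> is meant to be an initial segment. \<open>Card_order\<close> says that it is an initial ordinal.
\<close>

definition is_cardinal :: "'k::wellorder set \<Rightarrow> bool" where
  "is_cardinal S \<longleftrightarrow> Card_order (ordrel S)"

definition infinite_regular_cardinal :: "'k::wellorder set \<Rightarrow> bool" where
  "infinite_regular_cardinal S \<longleftrightarrow> is_cardinal S \<and> infinite S \<and> regularCard (ordrel S)"

definition strongly_inaccessible :: "'k::wellorder itself \<Rightarrow> bool" where
  "strongly_inaccessible _ \<longleftrightarrow>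
     infinite_regular_cardinal (UNIV :: 'k set) \<and>
     natLeq <o |UNIV :: 'k set| \<and>
     (\<forall>\<alpha>::'k. |Pow {..<\<alpha>}| <o |UNIV :: 'k set| )"

text \<open>
  In the closure clause, the premises say that \<open>\<delta>\<close> is a limit ordinal in which \<open>C\<close> is unbounded.
\<close>

definition club :: "'k::wellorder set \<Rightarrow> bool" where
  "club C \<longleftrightarrow>
     (\<forall>\<alpha>. \<exists>\<gamma>\<in>C. \<alpha> < \<gamma>) \<and>
     (\<forall>\<delta>. {..<\<delta>} \<noteq> {} \<longrightarrow> (\<forall>\<xi><\<delta>. \<exists>\<gamma>\<in>C. \<xi> < \<gamma> \<and> \<gamma> < \<delta>) \<longrightarrow> \<delta> \<in> C)"

definition stationary :: "'k::wellorder set \<Rightarrow> bool" where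
  "stationary S \<longleftrightarrow> (\<forall>C. club C \<longrightarrow> S \<inter> C \<noteq> {})"

definition mahlo :: "'k::wellorder itself \<Rightarrow> bool" where
  "mahlo \<kappa> \<longleftrightarrow> strongly_inaccessible \<kappa> \<and>
     stationary {\<mu>::'k. infinite_regular_cardinal {..<\<mu>}}"

definition diamond :: "'k::wellorder itself \<Rightarrow> bool" where
  "diamond _ \<longleftrightarrow> (\<exists>A :: 'k \<Rightarrow> 'k set. (\<forall>\<alpha>. A \<alpha> \<subseteq> {..<\<alpha>}) \<and>
     (\<forall>X. stationary {\<alpha>. X \<inter> {..<\<alpha>} = A \<alpha>}))"

text \<open>
  The requirement \<open>b \<alpha> \<ge> 3\<close> is part of \<open>b \<alpha>\<close> being infinite.
\<close>

definition R_plus :: "('k::wellorder \<Rightarrow> 'k) set" where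
  "R_plus = {b. strict_mono b \<and>
     (\<forall>\<alpha>. infinite_regular_cardinal {..<b \<alpha>} \<and> \<alpha> < b \<alpha>)}"

text \<open>
  \<open>id_plus \<alpha>\<close> is the least cardinal above \<open>|\<alpha>|\<close>, as an ordinal below \<open>\<kappa>\<close>; it exists there when
  \<open>\<kappa>\<close> is a limit cardinal. For finite \<open>\<alpha>\<close> it is \<open>\<alpha> + 1\<close>.
\<close>

definition id_plus :: "'k::wellorder \<Rightarrow> 'k" where
  "id_plus \<alpha> = (LEAST \<mu>. is_cardinal {..<\<mu>} \<and> |{..<\<alpha>}| <o |{..<\<mu>}| )"

definition bounded_functions :: "('k::wellorder \<Rightarrow> 'k) \<Rightarrow> ('k \<Rightarrow> 'k) set" where
  "bounded_functions b = (\<Pi> \<alpha>\<in>UNIV. {..<b \<alpha>})"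

definition Loc :: "('k::wellorder \<Rightarrow> 'k) \<Rightarrow> ('k \<Rightarrow> 'k) \<Rightarrow> ('k \<Rightarrow> 'k set) set" where
  "Loc b h = (\<Pi> \<alpha>\<in>UNIV. {A. A \<subseteq> {..<b \<alpha>} \<and> |A| <o |{..<h \<alpha>}| })"

definition antilocalises :: "('k::wellorder \<Rightarrow> 'k set) \<Rightarrow> ('k \<Rightarrow> 'k) \<Rightarrow> bool" where
  "antilocalises \<phi> f \<longleftrightarrow> (\<exists>\<alpha>. \<forall>\<beta>\<ge>\<alpha>. f \<beta> \<notin> \<phi> \<beta>)"

definition le_star :: "('k::wellorder \<Rightarrow> 'k) \<Rightarrow> ('k \<Rightarrow> 'k) \<Rightarrow> bool"  (infix "\<le>*" 50) where
  "f \<le>* g \<longleftrightarrow> (\<exists>\<alpha>. \<forall>\<beta>\<ge>\<alpha>. f \<beta> \<le> g \<beta>)"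

text \<open>
  Meaningful for a nonempty family of sets, see \<open>least_size_exists\<close>. The families to which it is
  applied below are nonempty, see \<open>UNIV_dominating\<close> and \<open>bounded_functions_antilocalising\<close>.
\<close>

definition least_size :: "'a set set \<Rightarrow> 'a rel" where
  "least_size F = |SOME G. G \<in> F \<and> (\<forall>H\<in>F. |G| \<le>o |H| )|"

definition d_le_star :: "('k::wellorder \<Rightarrow> 'k) set \<Rightarrow> ('k \<Rightarrow> 'k) rel" where
  "d_le_star X = least_size {G. G \<subseteq> X \<and> (\<forall>f\<in>X. \<exists>g\<in>G. f \<le>* g)}"

definition d_antiloc :: "('k::wellorder \<Rightarrow> 'k) \<Rightarrow> ('k \<Rightarrow> 'k) \<Rightarrow> ('k \<Rightarrow> 'k) rel" where
  "d_antiloc b h = least_size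
     {G. G \<subseteq> bounded_functions b \<and> (\<forall>\<phi>\<in>Loc b h. \<exists>f\<in>G. antilocalises \<phi> f)}"

lemma least_size_exists:
  assumes "F \<noteq> {}"
  shows "\<exists>G\<in>F. least_size F = |G| \<and> (\<forall>H\<in>F. |G| \<le>o |H| )"
proof -
  have "\<exists>r\<in>card_of ` F. \<forall>r'\<in>card_of ` F. r \<le>o r'"
    using assms by (intro exists_minim_Card_order) (auto simp: card_of_Card_order)
  then have "\<exists>G. G \<in> F \<and> (\<forall>H\<in>F. |G| \<le>o |H| )" by auto
  from someI_ex[OF this] show ?thesis unfolding least_size_def by blast
qed

lemma UNIV_dominating: "X \<in> {G. G \<subseteq> X \<and> (\<forall>f\<in>X. \<exists>g\<in>G. f \<le>* g)}"
  by (auto simp: le_star_def)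

lemma bounded_functions_antilocalising:
  assumes "\<And>\<alpha>. h \<alpha> \<le> b \<alpha>"
  shows "bounded_functions b \<in>
    {G. G \<subseteq> bounded_functions b \<and> (\<forall>\<phi>\<in>Loc b h. \<exists>f\<in>G. antilocalises \<phi> f)}"
proof -
  have "\<exists>f\<in>bounded_functions b. antilocalises \<phi> f" if \<phi>: "\<phi> \<in> Loc b h" for \<phi>
  proof -
    have "\<exists>x<b \<alpha>. x \<notin> \<phi> \<alpha>" for \<alpha>
    proof (rule ccontr)
      assume "\<not> ?thesis"
      then have "{..<h \<alpha>} \<subseteq> \<phi> \<alpha>" using assms[of \<alpha>] by auto
      then have "|{..<h \<alpha>}| \<le>o |\<phi> \<alpha>|" by (rule card_of_mono1)
      moreover have "|\<phi> \<alpha>| <o |{..<h \<alpha>}|" using \<phi> by (auto simp: Loc_def)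
      ultimately show False using not_ordLess_ordLeq by blast
    qed
    then obtain f where "\<And>\<alpha>. f \<alpha> < b \<alpha> \<and> f \<alpha> \<notin> \<phi> \<alpha>" by metis
    then show ?thesis
      by (intro bexI[of _ f]) (auto simp: bounded_functions_def antilocalises_def)
  qed
  then show ?thesis by blast
qed

lemma id_plus_R_plus:
  assumes "b \<in> R_plus"
  shows "is_cardinal {..<id_plus \<alpha>}" "|{..<\<alpha>}| <o |{..<id_plus \<alpha>}|" "id_plus \<alpha> \<le> b \<alpha>"
proof -
  let ?r = "ordrel {..<b \<alpha>}"
  have F: "Field ?r = {..<b \<alpha>}" by (auto simp: ordrel_def Field_def)
  have \<alpha>: "\<alpha> < b \<alpha>" and c: "Card_order ?r"
    using assms by (auto simp: R_plus_def infinite_regular_cardinal_def is_cardinal_def)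
  have "underS ?r \<alpha> = {..<\<alpha>}" using \<alpha> by (auto simp: underS_def ordrel_def)
  then have "|{..<\<alpha>}| <o ?r" using card_of_underS[OF c, of \<alpha>] \<alpha> F by auto
  moreover have "?r =o |{..<b \<alpha>}|"
    using card_of_Field_ordIso[OF c] F by (simp add: ordIso_symmetric)
  ultimately have *: "is_cardinal {..<b \<alpha>} \<and> |{..<\<alpha>}| <o |{..<b \<alpha>}|"
    using c ordLess_ordIso_trans by (auto simp: is_cardinal_def)
  show "is_cardinal {..<id_plus \<alpha>}" "|{..<\<alpha>}| <o |{..<id_plus \<alpha>}|"
    using LeastI[where P = "\<lambda>\<mu>. is_cardinal {..<\<mu>} \<and> |{..<\<alpha>}| <o |{..<\<mu>}|", OF *]
    unfolding id_plus_def by blast+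
  show "id_plus \<alpha> \<le> b \<alpha>"
    unfolding id_plus_def using * by (rule Least_le[where P = "\<lambda>\<mu>. is_cardinal {..<\<mu>} \<and> |{..<\<alpha>}| <o |{..<\<mu>}|"])
qed

end

theory Submission
  imports Defs
begin

text \<open>
  The last two relations follow by comparing witnesses: a slalom of width \<open>< b\<close> is pointwise bounded
  below \<open>b\<close> by regularity. For the first one, let \<open>C\<close> be a club of non-regular ordinals and let
  \<open>T g \<subseteq> C\<close> be the stationary set of points where the diamond sequence guesses \<open>g\<close> correctly.
  The map sending \<open>g\<close> to the function ``next element of \<open>T g\<close>'' turns an antilocalising family into
  a dominating one. Indeed, given \<open>f\<close>, let \<open>E\<close> be the club of its closure points. Since \<open>C\<close> has no
  regular elements, \<open>C - E\<close> carries a regressive function \<open>r\<close> whose fibre over \<open>\<beta>\<close> has at most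
  \<open>|\<beta>|\<close> elements. The slalom \<open>\<phi> \<beta>\<close> collects the values at \<open>\<beta>\<close> guessed at the
  points \<open>\<alpha>\<close> with \<open>r \<alpha> = \<beta>\<close>. If \<open>g\<close> eventually avoids \<open>\<phi>\<close>, then \<open>T g\<close> is eventually contained in \<open>E\<close>, so the
  next element of \<open>T g\<close> after \<open>\<xi>\<close> is closed under \<open>f\<close> and hence lies above \<open>f \<xi>\<close>.
\<close>

section \<open>Initial segments and small cofinal subsets\<close>

lemma Field_ordrel [simp]: "Field (ordrel S) = S"
  by (auto simp: ordrel_def Field_def)

lemma Well_order_ordrel: "Well_order (ordrel (S :: 'k::wellorder set))"
proof -
  have "Linear_order (ordrel S)"
    unfolding linear_order_on_def partial_order_on_def preorder_on_def
    by (auto simp: ordrel_def Field_def refl_on_def trans_def antisym_def total_on_def)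
  moreover have "wf (ordrel S - Id)"
    by (rule wf_subset[OF wf]) (auto simp: ordrel_def)
  ultimately show ?thesis by (simp add: well_order_on_def)
qed

lemma card_of_ordIso_ordrel: "is_cardinal S \<Longrightarrow> |S| =o ordrel S"
  using card_of_Field_ordIso[of "ordrel S"] by (simp add: is_cardinal_def)

text \<open>A well-order of smaller type is isomorphic to a proper initial segment, here the
  predecessors of some \<open>l\<close>.\<close>

lemma card_of_ordLess_ordrel_segment:
  assumes "|A| <o ordrel {..<\<eta> :: 'k::wellorder}"
  shows "\<exists>l<\<eta>. |A| \<le>o |{..<l}|"
proof -
  obtain l where l: "l \<in> {..<\<eta>}"
    and iso: "|A| =o Restr (ordrel {..<\<eta>}) (underS (ordrel {..<\<eta>}) l)"
    using iffD1[OF ordLess_iff_ordIso_Restr[OF Well_order_ordrel card_of_Well_order] assms] by (auto simp only: Field_ordrel)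
  have "|A| \<le>o |Field (Restr (ordrel {..<\<eta>}) (underS (ordrel {..<\<eta>}) l))|"
    using card_of_mono2[OF ordIso_imp_ordLeq[OF iso]] by (simp add: Field_card_of)
  moreover have "Field (Restr (ordrel {..<\<eta>}) (underS (ordrel {..<\<eta>}) l)) \<subseteq> {..<l}"
    by (auto simp: Field_def ordrel_def underS_def)
  ultimately show ?thesis using l card_of_mono1 ordLeq_transitive by blast
qed

text \<open>If \<open>\<eta>\<close> is a cardinal, only regularity can fail, which gives a smaller
  cofinal set. If not, the whole segment has size below its order type and serves as
  \<open>K\<close>. Bounding the size by a point \<open>l < \<eta>\<close> later makes
  \<open>l\<close> available as a regressive value.\<close>

lemma not_regular_small_cofinal:
  fixes \<eta> :: "'k::wellorder"
  assumes "\<not> infinite_regular_cardinal {..<\<eta>}" "infinite {..<\<eta>}"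
    and limit: "\<And>x. x < \<eta> \<Longrightarrow> \<exists>y. x < y \<and> y < \<eta>"
  shows "\<exists>K l. K \<subseteq> {..<\<eta>} \<and> l < \<eta> \<and> |K| \<le>o |{..<l}| \<and> (\<forall>x<\<eta>. \<exists>k\<in>K. x < k)"
proof -
  let ?r = "ordrel {..<\<eta>}"
  have "\<exists>K\<subseteq>{..<\<eta>}. |K| <o ?r \<and> (\<forall>x<\<eta>. \<exists>k\<in>K. x < k)"
  proof (cases "is_cardinal {..<\<eta>}")
    case True
    then obtain K where K: "K \<subseteq> {..<\<eta>}" "cofinal K ?r" "\<not> |K| =o ?r"
      using assms unfolding infinite_regular_cardinal_def regularCard_def by auto
    have "|K| \<le>o ?r"
      using card_of_mono1[OF K(1)] card_of_ordIso_ordrel[OF True] ordLeq_ordIso_trans by blast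
    then have "|K| <o ?r" using K(3) ordLeq_iff_ordLess_or_ordIso by blast
    moreover have "\<exists>k\<in>K. x < k" if "x < \<eta>" for x
    proof -
      have "x \<in> Field ?r" using that by simp
      then obtain k where "k \<in> K" "x \<noteq> k" "(x, k) \<in> ?r" using K(2) unfolding cofinal_def by blast
      then show ?thesis by (auto simp: ordrel_def intro!: bexI[of _ k])
    qed
    ultimately show ?thesis using K(1) by blast
  next
    case False
    have "|{..<\<eta>}| \<le>o ?r"
      using card_of_least[of "{..<\<eta>}" ?r] Well_order_ordrel[of "{..<\<eta>}"] by simp
    moreover have "\<not> |{..<\<eta>}| =o ?r"
      using False Card_order_ordIso2[OF card_of_Card_order] unfolding is_cardinal_def by blast
    ultimately have "|{..<\<eta>}| <o ?r" using ordLeq_iff_ordLess_or_ordIso by blast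
    then show ?thesis using limit by (intro exI[of _ "{..<\<eta>}"]) auto
  qed
  then obtain K where K: "K \<subseteq> {..<\<eta>}" "|K| <o ?r" "\<forall>x<\<eta>. \<exists>k\<in>K. x < k" by blast
  obtain l where "l < \<eta>" "|K| \<le>o |{..<l}|"
    using card_of_ordLess_ordrel_segment[OF K(2)] by blast
  then show ?thesis using K(1,3) by (intro exI[of _ K] exI[of _ l] conjI)
qed

section \<open>Clubs and stationary sets below an inaccessible cardinal\<close>

context
  assumes inacc: "strongly_inaccessible TYPE('k::wellorder)"
begin

lemma card_of_UNIV_ordIso: "|UNIV :: 'k set| =o ordrel (UNIV :: 'k set)"
  using inacc card_of_ordIso_ordrel
  by (auto simp only: strongly_inaccessible_def infinite_regular_cardinal_def)

lemma infinite_UNIV: "infinite (UNIV :: 'k set)"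
  using inacc by (simp add: strongly_inaccessible_def infinite_regular_cardinal_def)

lemma card_of_segment: "|{..<x :: 'k}| <o |UNIV :: 'k set|"
  using inacc card_of_Pow ordLess_transitive unfolding strongly_inaccessible_def by blast

lemma no_max: "\<exists>y. (x :: 'k) < y"
proof -
  have "\<exists>b. x \<noteq> b \<and> (x, b) \<in> ordrel UNIV"
    using infinite_Card_order_limit[of "ordrel UNIV" x] inacc
    by (auto simp: strongly_inaccessible_def infinite_regular_cardinal_def is_cardinal_def)
  then show ?thesis by (auto simp: ordrel_def order_le_less)
qed

text \<open>By regularity such a set is not cofinal. Since \<open>cofinal\<close> is strict, its
  failure gives only a weak bound, which \<open>no_max\<close> makes strict.\<close>

lemma small_bounded:
  fixes A :: "'k set"
  assumes "|A| <o |UNIV :: 'k set|"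
  shows "\<exists>x. \<forall>a\<in>A. a < x"
proof -
  have "\<not> |A| =o ordrel (UNIV :: 'k set)"
    using assms card_of_UNIV_ordIso not_ordLess_ordIso ordIso_transitive ordIso_symmetric by blast
  then have "\<not> cofinal A (ordrel (UNIV :: 'k set))"
    using inacc by (auto simp: strongly_inaccessible_def infinite_regular_cardinal_def regularCard_def)
  then obtain x where "\<forall>a\<in>A. a \<le> x"
    by (force simp: cofinal_def ordrel_def)
  then show ?thesis using no_max[of x] by (meson le_less_trans)
qed

text \<open>The supremum of an omega-sequence in which each term exceeds the \<open>F\<close>-values
  below its predecessor; regularity and uncountability keep the sequence bounded.\<close>

lemma closure_points_unbounded:
  fixes F :: "'k \<Rightarrow> 'k"
  shows "\<exists>\<delta>>\<alpha>. \<forall>\<xi><\<delta>. F \<xi> < \<delta>"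
proof -
  have "\<exists>y>x. \<forall>a<x. F a < y" for x
  proof -
    have "|F ` {..<x}| <o |UNIV :: 'k set|"
      using card_of_image card_of_segment ordLeq_ordLess_trans by blast
    then obtain y where "\<forall>a\<in>F ` {..<x}. a < y" using small_bounded by blast
    moreover obtain z where "x < z" using no_max by blast
    ultimately show ?thesis by (intro exI[of _ "max y z"]) (auto simp: less_max_iff_disj)
  qed
  then obtain N where N: "\<And>x. x < N x" "\<And>x a. a < x \<Longrightarrow> F a < N x" by metis
  define d where "d n = (N ^^ n) (N \<alpha>)" for n :: nat
  have d: "d n < d (Suc n)" "a < d n \<Longrightarrow> F a < d (Suc n)" for n a
    using N by (auto simp: d_def)
  have "|range d| \<le>o natLeq"
    using card_of_image card_of_nat ordLeq_ordIso_trans by blast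
  then have "|range d| <o |UNIV :: 'k set|"
    using inacc unfolding strongly_inaccessible_def using ordLeq_ordLess_trans by blast
  from small_bounded[OF this] obtain u where u: "\<And>n. d n \<le> u" by (auto intro: less_imp_le)
  define \<delta> where "\<delta> = (LEAST x. \<forall>n. d n \<le> x)"
  have le: "d n \<le> \<delta>" for n
    using LeastI[of "\<lambda>x. \<forall>n. d n \<le> x" u] u unfolding \<delta>_def by blast
  have lt: "d n < \<delta>" for n using d(1)[of n] le[of "Suc n"] by simp
  have "F \<xi> < \<delta>" if "\<xi> < \<delta>" for \<xi>
  proof -
    have "\<not> (\<forall>n. d n \<le> \<xi>)" using that not_less_Least unfolding \<delta>_def by blast
    then obtain n where "\<xi> < d n" by (meson not_le)
    then show ?thesis using d(2) le order_less_le_trans by blast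
  qed
  moreover have "\<alpha> < \<delta>" using lt[of 0] N(1)[of \<alpha>] by (simp add: d_def)
  ultimately show ?thesis by blast
qed

lemma club_closure_points: "club {\<delta>. \<forall>\<xi><\<delta>. F \<xi> < (\<delta> :: 'k)}"
proof -
  have "\<exists>\<delta>\<in>{\<delta>. \<forall>\<xi><\<delta>. F \<xi> < \<delta>}. \<alpha> < \<delta>" for \<alpha>
    using closure_points_unbounded[of \<alpha> F] by auto
  moreover have "F \<xi> < \<delta>"
    if \<delta>: "\<forall>\<xi><\<delta>. \<exists>\<gamma>\<in>{\<delta>. \<forall>\<xi><\<delta>. F \<xi> < \<delta>}. \<xi> < \<gamma> \<and> \<gamma> < \<delta>" "\<xi> < \<delta>" for \<delta> \<xi>
  proof -
    obtain \<gamma> where "\<forall>\<xi><\<gamma>. F \<xi> < \<gamma>" "\<xi> < \<gamma>" "\<gamma> < \<delta>" using \<delta> by blast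
    then show ?thesis by (meson less_trans)
  qed
  ultimately show ?thesis unfolding club_def by blast
qed

lemma club_Int:
  assumes "club C" "club (D :: 'k set)"
  shows "club (C \<inter> D)"
proof -
  obtain c where c: "\<And>\<alpha>. c \<alpha> \<in> C \<and> \<alpha> < c \<alpha>" using assms(1) unfolding club_def by metis
  obtain d where d: "\<And>\<alpha>. d \<alpha> \<in> D \<and> \<alpha> < d \<alpha>" using assms(2) unfolding club_def by metis
  have "\<exists>\<delta>\<in>C \<inter> D. \<alpha> < \<delta>" for \<alpha>
  proof -
    \<comment> \<open>A closure point of \<open>c\<close> and \<open>d\<close> jointly is a limit of
      both clubs, hence in both.\<close>
    obtain \<delta> where \<delta>: "\<delta> > \<alpha>" "\<And>\<xi>. \<xi> < \<delta> \<Longrightarrow> max (c \<xi>) (d \<xi>) < \<delta>"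
      using closure_points_unbounded[of \<alpha> "\<lambda>\<xi>. max (c \<xi>) (d \<xi>)"] by blast
    have ne: "{..<\<delta>} \<noteq> {}" using \<delta>(1) by auto
    have "\<delta> \<in> C"
      using assms(1) ne c \<delta>(2) unfolding club_def by (meson max_less_iff_conj)
    moreover have "\<delta> \<in> D"
      using assms(2) ne d \<delta>(2) unfolding club_def by (meson max_less_iff_conj)
    ultimately show ?thesis using \<delta>(1) by blast
  qed
  moreover have "\<delta> \<in> C \<inter> D"
    if "{..<\<delta>} \<noteq> {}" "\<forall>\<xi><\<delta>. \<exists>\<gamma>\<in>C \<inter> D. \<xi> < \<gamma> \<and> \<gamma> < \<delta>" for \<delta>
    using assms that unfolding club_def by (metis IntD1 IntD2 IntI)
  ultimately show ?thesis unfolding club_def by blast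
qed

lemma club_greaterThan: "club {\<alpha> :: 'k<..}"
proof -
  have "\<exists>\<gamma>\<in>{\<alpha><..}. \<beta> < \<gamma>" for \<beta>
    using no_max[of "max \<alpha> \<beta>"] by auto
  moreover have "\<delta> \<in> {\<alpha><..}"
    if "{..<\<delta>} \<noteq> {}" "\<forall>\<xi><\<delta>. \<exists>\<gamma>\<in>{\<alpha><..}. \<xi> < \<gamma> \<and> \<gamma> < \<delta>" for \<delta>
    using that by (auto intro: less_trans)
  ultimately show ?thesis unfolding club_def by blast
qed

lemma stationary_Int_club: "stationary S \<Longrightarrow> club C \<Longrightarrow> stationary (S \<inter> (C :: 'k set))"
  unfolding stationary_def using club_Int by (metis Int_assoc)

lemma stationary_unbounded: "stationary (S :: 'k set) \<Longrightarrow> \<exists>\<gamma>\<in>S. \<alpha> < \<gamma>"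
  using club_greaterThan[of \<alpha>] unfolding stationary_def by fastforce

end

section \<open>Regressive functions with small fibres\<close>

text \<open>The bound on the fibre is the slalom width allowed at \<open>\<beta>\<close>. The base
  \<open>w\<close> will be infinite and no value is below it, so every nonempty fibre lies over an
  infinite \<open>\<beta>\<close>, and unions of \<open>|\<beta>|\<close> many sets of that size
  stay that small.\<close>

definition thin :: "'k::wellorder \<Rightarrow> 'k set \<Rightarrow> ('k \<Rightarrow> 'k) \<Rightarrow> bool" where
  "thin w D r \<longleftrightarrow> (\<forall>\<alpha>\<in>D. w \<le> r \<alpha> \<and> r \<alpha> < \<alpha>) \<and>
     (\<forall>\<beta>\<ge>w. |{\<alpha>\<in>D. r \<alpha> = \<beta>}| \<le>o |{..<\<beta>}| )"

lemma infinite_segment_mono: "infinite {..<w :: 'k::wellorder} \<Longrightarrow> w \<le> \<beta> \<Longrightarrow> infinite {..<\<beta>}"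
  by (meson finite_subset lessThan_subset_iff)

lemma card_of_Un_le:
  "infinite B \<Longrightarrow> |A1| \<le>o |B| \<Longrightarrow> |A2| \<le>o |B| \<Longrightarrow> |A1 \<union> A2| \<le>o |B|"
  by (rule card_of_Un_ordLeq_infinite_Field) (simp_all add: Field_card_of card_of_card_order_on)

lemma finite_card_of_le: "finite A \<Longrightarrow> infinite B \<Longrightarrow> |A| \<le>o |B|"
  using card_of_ordLeq_finite not_ordLeq_iff_ordLess[OF card_of_Well_order card_of_Well_order]
    ordLess_imp_ordLeq by blast

lemma thin_mono: "thin w D r \<Longrightarrow> D' \<subseteq> D \<Longrightarrow> thin w D' r"
proof -
  assume *: "thin w D r" "D' \<subseteq> D"
  have "|{\<alpha>\<in>D'. r \<alpha> = \<beta>}| \<le>o |{\<alpha>\<in>D. r \<alpha> = \<beta>}|" for \<beta>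
    using *(2) by (intro card_of_mono1) auto
  then show ?thesis using * unfolding thin_def by (meson ordLeq_transitive subsetD)
qed

text \<open>Each fibre is covered by the two old fibres over the same \<open>\<beta>\<close>, and an
  infinite \<open>\<beta>\<close> absorbs the union.\<close>

lemma thin_Un:
  assumes w: "infinite {..<w :: 'k::wellorder}" and "thin w D r" "thin w D' r'"
  shows "\<exists>r. thin w (D \<union> D') r"
proof
  let ?r = "\<lambda>\<alpha>. if \<alpha> \<in> D then r \<alpha> else r' \<alpha>"
  have "|{\<alpha>\<in>D \<union> D'. ?r \<alpha> = \<beta>}| \<le>o |{..<\<beta>}|" if "w \<le> \<beta>" for \<beta>
  proof -
    have "|{\<alpha>\<in>D. r \<alpha> = \<beta>} \<union> {\<alpha>\<in>D'. r' \<alpha> = \<beta>}| \<le>o |{..<\<beta>}|"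
      using assms that infinite_segment_mono[OF w that]
      by (intro card_of_Un_le) (auto simp: thin_def)
    moreover have "|{\<alpha>\<in>D \<union> D'. ?r \<alpha> = \<beta>}| \<le>o |{\<alpha>\<in>D. r \<alpha> = \<beta>} \<union> {\<alpha>\<in>D'. r' \<alpha> = \<beta>}|"
      by (intro card_of_mono1) auto
    ultimately show ?thesis using ordLeq_transitive by blast
  qed
  then show "thin w (D \<union> D') ?r" using assms by (auto simp: thin_def)
qed

lemma thin_const:
  assumes "|D| \<le>o |{..<l}|" "w \<le> l" "\<And>\<alpha>. \<alpha> \<in> D \<Longrightarrow> l < \<alpha>"
  shows "thin w D (\<lambda>_. l)"
proof -
  have "|{\<alpha>\<in>D. l = \<beta>}| \<le>o |{..<\<beta>}|" for \<beta>
    using assms(1) by (cases "l = \<beta>") (auto intro: card_of_empty)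
  then show ?thesis using assms by (auto simp: thin_def)
qed

text \<open>The supremum of the elements of \<open>K\<close> below \<open>k\<close>; it need not lie
  in \<open>K\<close>, and is the least element of the type if there are none.\<close>

definition gap :: "'k::wellorder set \<Rightarrow> 'k \<Rightarrow> 'k" where
  "gap K k = (LEAST x. \<forall>j\<in>K. j < k \<longrightarrow> j \<le> x)"

definition next_in :: "'k::wellorder set \<Rightarrow> 'k \<Rightarrow> 'k" where
  "next_in K \<alpha> = (LEAST k. k \<in> K \<and> \<alpha> \<le> k)"

lemma gap_upper: "j \<in> K \<Longrightarrow> j < k \<Longrightarrow> j \<le> gap K k"
  using LeastI[of "\<lambda>x. \<forall>j\<in>K. j < k \<longrightarrow> j \<le> x" k] unfolding gap_def by (simp add: less_imp_le)

lemma gap_least: "(\<And>j. j \<in> K \<Longrightarrow> j < k \<Longrightarrow> j \<le> x) \<Longrightarrow> gap K k \<le> x"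
  unfolding gap_def by (rule Least_le) auto

lemma next_in: "k \<in> K \<Longrightarrow> \<alpha> \<le> k \<Longrightarrow> next_in K \<alpha> \<in> K \<and> \<alpha> \<le> next_in K \<alpha>"
  unfolding next_in_def by (rule LeastI[of "\<lambda>k. k \<in> K \<and> \<alpha> \<le> k"]) auto

lemma less_next_in: "j \<in> K \<Longrightarrow> j < next_in K \<alpha> \<Longrightarrow> j < \<alpha>"
  unfolding next_in_def using not_less_Least by (metis (mono_tags, lifting) not_le)

text \<open>All elements of \<open>K\<close> below \<open>next_in K \<alpha>\<close> are below
  \<open>\<alpha>\<close>, so \<open>\<alpha>\<close> bounds them.\<close>

lemma gap_next_in: "gap K (next_in K \<alpha>) \<le> \<alpha>"
  by (rule gap_least) (auto dest: less_next_in)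

text \<open>
  The intervals from \<open>gap K k\<close> to \<open>k\<close>, for \<open>k \<in> K\<close>, are disjoint. Raising the \<open>k\<close>-th function to
  at least \<open>gap K k\<close> keeps its values there in the \<open>k\<close>-th interval, so different \<open>k\<close> do not share fibres.
\<close>

lemma thin_glue:
  assumes w: "infinite {..<w :: 'k::wellorder}"
    and K: "\<And>k. k \<in> K \<Longrightarrow> \<exists>r. thin w (D \<inter> {..k}) r"
    and cover: "\<And>\<alpha>. \<alpha> \<in> D \<Longrightarrow> \<exists>k\<in>K. \<alpha> \<le> k"
    and no_gap: "\<And>\<alpha>. \<alpha> \<in> D \<Longrightarrow> \<alpha> \<noteq> gap K (next_in K \<alpha>)"
  shows "\<exists>r. thin w D r"
proof -
  obtain r where r: "\<And>k. k \<in> K \<Longrightarrow> thin w (D \<inter> {..k}) (r k)" using K by metis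
  define R where "R \<alpha> = max (gap K (next_in K \<alpha>)) (r (next_in K \<alpha>) \<alpha>)" for \<alpha>
  have nx: "next_in K \<alpha> \<in> K" "\<alpha> \<le> next_in K \<alpha>" if "\<alpha> \<in> D" for \<alpha>
    using cover[OF that] next_in by blast+
  have rn: "w \<le> r (next_in K \<alpha>) \<alpha>" "r (next_in K \<alpha>) \<alpha> < \<alpha>" if "\<alpha> \<in> D" for \<alpha>
    using r[OF nx(1)[OF that]] nx[OF that] that by (auto simp: thin_def)
  \<comment> \<open>\<open>no_gap\<close> makes the maximum regressive: it excludes the points where
    the lower endpoint is \<open>\<alpha>\<close> itself.\<close>
  have R: "w \<le> R \<alpha>" "R \<alpha> < \<alpha>" "gap K (next_in K \<alpha>) \<le> R \<alpha>" if "\<alpha> \<in> D" for \<alpha>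
    using rn[OF that] no_gap[OF that] gap_next_in[of K \<alpha>]
    by (auto simp: R_def le_max_iff_disj)
  have same: "next_in K \<alpha> = next_in K \<alpha>'"
    if "\<alpha> \<in> D" "\<alpha>' \<in> D" "R \<alpha> = R \<alpha>'" for \<alpha> \<alpha>'
  proof -
    \<comment> \<open>If the intervals differed, the earlier right endpoint would be at most the
      later gap, hence at most the common value, yet that value is below \<open>\<alpha>\<close> and
      so below the earlier endpoint.\<close>
    have False if "\<alpha> \<in> D" "\<alpha>' \<in> D" "R \<alpha> = R \<alpha>'" "next_in K \<alpha> < next_in K \<alpha>'" for \<alpha> \<alpha>'
      using gap_upper[OF nx(1)[OF that(1)] that(4)] R(3)[OF that(2)] R(2)[OF that(1)]
        nx(2)[OF that(1)] that(3) by auto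
    then show ?thesis using that by (metis not_less_iff_gr_or_eq)
  qed
  have "|{\<alpha>\<in>D. R \<alpha> = \<beta>}| \<le>o |{..<\<beta>}|" if \<beta>: "w \<le> \<beta>" for \<beta>
  proof (cases "\<exists>\<alpha>\<in>D. R \<alpha> = \<beta>")
    case True
    then obtain \<alpha>0 where \<alpha>0: "\<alpha>0 \<in> D" "R \<alpha>0 = \<beta>" by blast
    define k where "k = next_in K \<alpha>0"
    have k: "k \<in> K" using nx \<alpha>0 k_def by blast
    have inf: "infinite {..<\<beta>}" using infinite_segment_mono[OF w \<beta>] .
    \<comment> \<open>Within one interval the value \<open>\<beta>\<close> of the maximum bounds
      \<open>r k\<close>, so the fibre is covered by the fibres of \<open>r k\<close> over the
      points from \<open>w\<close> to \<open>\<beta>\<close>, at most \<open>|\<beta>|\<close>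
      many.\<close>
    have sub: "{\<alpha>\<in>D. R \<alpha> = \<beta>} \<subseteq> (\<Union>\<gamma>\<in>{w..<\<beta>} \<union> {\<beta>}. {\<alpha>\<in>D \<inter> {..k}. r k \<alpha> = \<gamma>})"
    proof
      fix \<alpha> assume "\<alpha> \<in> {\<alpha>\<in>D. R \<alpha> = \<beta>}"
      then have \<alpha>: "\<alpha> \<in> D" "R \<alpha> = \<beta>" by auto
      have kn: "next_in K \<alpha> = k" unfolding k_def using same[OF \<alpha>(1) \<alpha>0(1)] \<alpha>(2) \<alpha>0(2) by metis
      have "w \<le> r k \<alpha>" "r k \<alpha> \<le> \<beta>" "\<alpha> \<le> k"
        using rn(1)[OF \<alpha>(1)] \<alpha>(2) nx(2)[OF \<alpha>(1)] unfolding R_def kn by auto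
      then show "\<alpha> \<in> (\<Union>\<gamma>\<in>{w..<\<beta>} \<union> {\<beta>}. {\<alpha>\<in>D \<inter> {..k}. r k \<alpha> = \<gamma>})"
        using \<alpha> by auto
    qed
    have "|{w..<\<beta>} \<union> {\<beta>}| \<le>o |{..<\<beta>}|"
      using inf by (intro card_of_Un_le card_of_mono1 finite_card_of_le) auto
    moreover have "|{\<alpha>\<in>D \<inter> {..k}. r k \<alpha> = \<gamma>}| \<le>o |{..<\<beta>}|" if "\<gamma> \<in> {w..<\<beta>} \<union> {\<beta>}" for \<gamma>
    proof -
      have "|{\<alpha>\<in>D \<inter> {..k}. r k \<alpha> = \<gamma>}| \<le>o |{..<\<gamma>}|"
        using r[OF k] that \<beta> by (auto simp: thin_def)
      also have "|{..<\<gamma>}| \<le>o |{..<\<beta>}|" using that by (intro card_of_mono1) auto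
      finally show ?thesis .
    qed
    ultimately have "|\<Union>\<gamma>\<in>{w..<\<beta>} \<union> {\<beta>}. {\<alpha>\<in>D \<inter> {..k}. r k \<alpha> = \<gamma>}| \<le>o |{..<\<beta>}|"
      using inf by (intro card_of_UNION_ordLeq_infinite) auto
    then show ?thesis using card_of_mono1[OF sub] ordLeq_transitive by blast
  next
    case False
    then have "{\<alpha>\<in>D. R \<alpha> = \<beta>} = {}" by blast
    then show ?thesis by (simp only: card_of_empty)
  qed
  then have "thin w D R" using R by (auto simp: thin_def)
  then show ?thesis by blast
qed

text \<open>
  Induction on \<open>\<eta>\<close>. A limit \<open>\<eta> \<in> C\<close> has a cofinal set of size at most \<open>|l|\<close> for some
  \<open>l < \<eta>\<close>; the points above \<open>l\<close> not reached by gluing along it are so few that all can be sent to \<open>l\<close>.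
\<close>

lemma thin_bounded:
  assumes w: "infinite {..<w :: 'k::wellorder}" and C: "club C"
    and sing: "\<And>\<mu>. \<mu> \<in> C \<Longrightarrow> \<not> infinite_regular_cardinal {..<\<mu>}"
  shows "\<exists>r. thin w (C \<inter> {w<..\<eta>}) r"
proof (induction \<eta> rule: less_induct)
  case (less \<eta>)
  show ?case
  proof (cases "w < \<eta>")
    case False
    then have "thin w (C \<inter> {w<..\<eta>}) (\<lambda>_. w)"
      by (intro thin_const) (auto simp: card_of_empty)
    then show ?thesis by blast
  next
    case wn: True
    show ?thesis
    proof (cases "\<exists>\<zeta><\<eta>. \<forall>\<alpha>\<in>C. \<alpha> < \<eta> \<longrightarrow> \<alpha> \<le> \<zeta>")
      case True
      then obtain \<zeta> where \<zeta>: "\<zeta> < \<eta>" "\<And>\<alpha>. \<alpha> \<in> C \<Longrightarrow> \<alpha> < \<eta> \<Longrightarrow> \<alpha> \<le> \<zeta>" by blast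
      obtain r where "thin w (C \<inter> {w<..\<zeta>}) r" using less \<zeta>(1) by blast
      \<comment> \<open>Only \<open>\<eta>\<close> is new. Its value is infinite, so a singleton
        fits as the fibre.\<close>
      moreover have "thin w {\<eta>} (\<lambda>_. max w \<zeta>)"
        using infinite_segment_mono[OF w, of "max w \<zeta>"] wn \<zeta>(1)
        by (intro thin_const finite_card_of_le) auto
      ultimately obtain r' where "thin w (C \<inter> {w<..\<zeta>} \<union> {\<eta>}) r'" using thin_Un[OF w] by blast
      moreover have "C \<inter> {w<..\<eta>} \<subseteq> C \<inter> {w<..\<zeta>} \<union> {\<eta>}"
      proof
        fix \<alpha> assume "\<alpha> \<in> C \<inter> {w<..\<eta>}"
        then show "\<alpha> \<in> C \<inter> {w<..\<zeta>} \<union> {\<eta>}" using \<zeta>(2)[of \<alpha>] by (cases "\<alpha> = \<eta>") auto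
      qed
      ultimately show ?thesis using thin_mono by blast
    next
      case False
      then have lim: "\<forall>\<xi><\<eta>. \<exists>\<gamma>\<in>C. \<xi> < \<gamma> \<and> \<gamma> < \<eta>" by (meson not_le)
      \<comment> \<open>Here \<open>\<eta>\<close> is a limit of \<open>C\<close>, so closedness
        puts it in \<open>C\<close> and makes it non-regular.\<close>
      then have "\<eta> \<in> C" using C wn unfolding club_def by blast
      then obtain K l0 where K: "K \<subseteq> {..<\<eta>}" "l0 < \<eta>" "|K| \<le>o |{..<l0}|" "\<forall>x<\<eta>. \<exists>k\<in>K. x < k"
        using not_regular_small_cofinal[OF sing infinite_segment_mono[OF w]] lim wn
        by (metis less_imp_le)
      define l where "l = max w l0"
      have l: "w \<le> l" "l < \<eta>" using wn K(2) by (auto simp: l_def)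
      have inf: "infinite {..<l}" using infinite_segment_mono[OF w l(1)] .
      have "|{..<l0}| \<le>o |{..<l}|" by (intro card_of_mono1) (auto simp: l_def)
      then have Kl: "|K| \<le>o |{..<l}|" using K(3) ordLeq_transitive by blast
      \<comment> \<open>A point of \<open>C\<close> between \<open>l\<close> and
        \<open>\<eta>\<close> is handled by gluing unless it is the gap of its own next element of
        \<open>K\<close>. At most \<open>|K|\<close> gaps occur, so \<open>?S\<close>, which also
        holds \<open>\<eta>\<close>, has size at most \<open>|l|\<close>.\<close>
      let ?D = "{\<alpha> \<in> C \<inter> {l<..<\<eta>}. \<alpha> \<noteq> gap K (next_in K \<alpha>)}"
      let ?S = "(gap K ` K \<inter> {l<..}) \<union> {\<eta>}"
      obtain r1 where r1: "thin w (C \<inter> {w<..l}) r1" using less l(2) by blast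
      have "\<exists>r. thin w ?D r"
      proof (rule thin_glue[OF w])
        fix k assume "k \<in> K"
        then have "k < \<eta>" using K(1) by auto
        then obtain r where "thin w (C \<inter> {w<..k}) r" using less by blast
        then have "thin w (?D \<inter> {..k}) r" by (rule thin_mono) (use l in auto)
        then show "\<exists>r. thin w (?D \<inter> {..k}) r" by blast
      next
        fix \<alpha> assume "\<alpha> \<in> ?D"
        then show "\<exists>k\<in>K. \<alpha> \<le> k" using K(4) by (auto intro: less_imp_le)
      qed auto
      then obtain r2 where r2: "thin w ?D r2" by blast
      have "|gap K ` K| \<le>o |{..<l}|" by (rule ordLeq_transitive[OF card_of_image Kl])
      then have "|gap K ` K \<inter> {l<..}| \<le>o |{..<l}|"
        by (rule ordLeq_transitive[OF card_of_mono1, rotated]) simp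
      then have "|?S| \<le>o |{..<l}|"
        by (rule card_of_Un_le[OF inf _ finite_card_of_le[OF _ inf]]) simp
      then have r3: "thin w ?S (\<lambda>_. l)" by (rule thin_const) (use l in auto)
      obtain r4 where "thin w (C \<inter> {w<..l} \<union> ?D) r4" using thin_Un[OF w r1 r2] by blast
      from thin_Un[OF w this r3]
      obtain r where r: "thin w (C \<inter> {w<..l} \<union> ?D \<union> ?S) r" by blast
      have "C \<inter> {w<..\<eta>} \<subseteq> C \<inter> {w<..l} \<union> ?D \<union> ?S"
      proof
        fix \<alpha> assume \<alpha>: "\<alpha> \<in> C \<inter> {w<..\<eta>}"
        show "\<alpha> \<in> C \<inter> {w<..l} \<union> ?D \<union> ?S"
        proof (cases "l < \<alpha> \<and> \<alpha> < \<eta> \<and> \<alpha> = gap K (next_in K \<alpha>)")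
          case True
          then obtain k where "k \<in> K" "\<alpha> \<le> k" using K(4) by (auto intro: less_imp_le)
          then have "next_in K \<alpha> \<in> K" using next_in by blast
          then have "\<alpha> \<in> gap K ` K" using True by blast
          then show ?thesis using True by blast
        qed (use \<alpha> in auto)
      qed
      then show ?thesis using thin_mono[OF r] by blast
    qed
  qed
qed

text \<open>The bounded pieces are glued along \<open>E\<close> itself. A point equal to the gap of
  its next element would be a limit of \<open>E\<close>, hence in \<open>E\<close>; so no
  exceptional points remain off \<open>E\<close>.\<close>

lemma thin_nonstationary:
  assumes w: "infinite {..<w :: 'k::wellorder}" and C: "club C" and E: "club E"
    and sing: "\<And>\<mu>. \<mu> \<in> C \<Longrightarrow> \<not> infinite_regular_cardinal {..<\<mu>}"
  shows "\<exists>r. thin w (C \<inter> {w<..} - E) r"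
proof (rule thin_glue[OF w, where K = E])
  fix k assume "k \<in> E"
  obtain r where "thin w (C \<inter> {w<..k}) r" using thin_bounded[OF w C sing] by blast
  then have "thin w ((C \<inter> {w<..} - E) \<inter> {..k}) r" by (rule thin_mono) auto
  then show "\<exists>r. thin w ((C \<inter> {w<..} - E) \<inter> {..k}) r" by blast
next
  fix \<alpha> show "\<exists>k\<in>E. \<alpha> \<le> k" using E unfolding club_def by (meson less_imp_le)
next
  fix \<alpha> assume \<alpha>: "\<alpha> \<in> C \<inter> {w<..} - E"
  show "\<alpha> \<noteq> gap E (next_in E \<alpha>)"
  proof
    assume g: "\<alpha> = gap E (next_in E \<alpha>)"
    have "\<exists>\<gamma>\<in>E. \<xi> < \<gamma> \<and> \<gamma> < \<alpha>" if "\<xi> < \<alpha>" for \<xi>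
    proof -
      have "\<not> (\<forall>j\<in>E. j < next_in E \<alpha> \<longrightarrow> j \<le> \<xi>)"
        using gap_least[of E "next_in E \<alpha>" \<xi>] g that by (metis not_le)
      then show ?thesis by (metis less_next_in not_le)
    qed
    moreover have "{..<\<alpha>} \<noteq> {}" using \<alpha> by auto
    ultimately have "\<alpha> \<in> E" using E unfolding club_def by blast
    then show False using \<alpha> by blast
  qed
qed

section \<open>Comparison of cardinals by witnesses\<close>

text \<open>The two memberships make both families nonempty, so both minima are attained; the
  minimal witness in \<open>F'\<close> has a counterpart in \<open>F\<close> that is no
  larger.\<close>

lemma least_size_mono:
  assumes "G \<in> F" and "H \<in> F'" and "\<And>H. H \<in> F' \<Longrightarrow> \<exists>G\<in>F. |G| \<le>o |H|"
  shows "least_size F \<le>o least_size F'"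
proof -
  obtain G where G: "least_size F = |G|" "\<forall>H\<in>F. |G| \<le>o |H|"
    using least_size_exists[of F] assms(1) by blast
  obtain H where H: "H \<in> F'" "least_size F' = |H|"
    using least_size_exists[of F'] assms(2) by blast
  obtain G' where G': "G' \<in> F" "|G'| \<le>o |H|" using assms(3)[OF H(1)] by blast
  have "|G| \<le>o |H|" using G(2) G' ordLeq_transitive by blast
  then show ?thesis using G(1) H(2) by simp
qed

text \<open>Regularity of \<open>b \<alpha>\<close> excludes cofinality of \<open>A\<close>; the
  resulting weak bound becomes strict since an infinite cardinal is a limit.\<close>

lemma R_plus_bounded:
  assumes "b \<in> R_plus" "A \<subseteq> {..<b \<alpha> :: 'k::wellorder}" "|A| <o |{..<b \<alpha>}|"
  shows "\<exists>x<b \<alpha>. \<forall>a\<in>A. a < x"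
proof -
  have reg: "infinite_regular_cardinal {..<b \<alpha>}" using assms(1) by (simp add: R_plus_def)
  have co: "|{..<b \<alpha>}| =o ordrel {..<b \<alpha>}"
    using reg card_of_ordIso_ordrel by (auto simp only: infinite_regular_cardinal_def)
  have "\<not> |A| =o ordrel {..<b \<alpha>}"
    using assms(3) co not_ordLess_ordIso ordIso_transitive ordIso_symmetric by blast
  then have "\<not> cofinal A (ordrel {..<b \<alpha>})"
    using reg assms(2) by (auto simp: infinite_regular_cardinal_def regularCard_def)
  then obtain x where x: "x < b \<alpha>" and nb: "\<And>a. a \<in> A \<Longrightarrow> x = a \<or> (x, a) \<notin> ordrel {..<b \<alpha>}"
    by (auto simp: cofinal_def)
  have le: "a \<le> x" if "a \<in> A" for a
    using nb[OF that] x that assms(2) by (auto simp: ordrel_def)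
  have "\<exists>y\<in>{..<b \<alpha>}. x \<noteq> y \<and> (x, y) \<in> ordrel {..<b \<alpha>}"
    using infinite_Card_order_limit[of "ordrel {..<b \<alpha>}" x] reg x
    by (simp add: infinite_regular_cardinal_def is_cardinal_def)
  then obtain y where "y < b \<alpha>" "x < y" by (auto simp: ordrel_def order_le_less)
  then show ?thesis using le by (meson le_less_trans)
qed

lemma Loc_mono:
  assumes "\<And>\<alpha>. h \<alpha> \<le> h' \<alpha>"
  shows "Loc b h \<subseteq> Loc b h'"
proof
  fix \<phi> assume "\<phi> \<in> Loc b h"
  moreover have "|{..<h \<alpha>}| \<le>o |{..<h' \<alpha>}|" for \<alpha>
    using assms[of \<alpha>] by (intro card_of_mono1) auto
  ultimately show "\<phi> \<in> Loc b h'" unfolding Loc_def Pi_iff using ordLess_ordLeq_trans by blast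
qed

text \<open>Slaloms of width below \<open>id_plus\<close> are among those of width below
  \<open>b\<close>, so a family evading the latter evades the former.\<close>

lemma d_antiloc_id_plus_le:
  assumes "b \<in> R_plus"
  shows "d_antiloc b id_plus \<le>o d_antiloc b b"
  unfolding d_antiloc_def
proof (rule least_size_mono)
  show "bounded_functions b \<in> {G. G \<subseteq> bounded_functions b \<and> (\<forall>\<phi>\<in>Loc b id_plus. \<exists>f\<in>G. antilocalises \<phi> f)}"
    by (rule bounded_functions_antilocalising) (rule id_plus_R_plus[OF assms])
  show "bounded_functions b \<in> {G. G \<subseteq> bounded_functions b \<and> (\<forall>\<phi>\<in>Loc b b. \<exists>f\<in>G. antilocalises \<phi> f)}"
    by (rule bounded_functions_antilocalising) simp
next
  fix H assume H: "H \<in> {G. G \<subseteq> bounded_functions b \<and> (\<forall>\<phi>\<in>Loc b b. \<exists>f\<in>G. antilocalises \<phi> f)}"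
  have "Loc b id_plus \<subseteq> Loc b b" by (rule Loc_mono) (rule id_plus_R_plus[OF assms])
  then have "H \<in> {G. G \<subseteq> bounded_functions b \<and> (\<forall>\<phi>\<in>Loc b id_plus. \<exists>f\<in>G. antilocalises \<phi> f)}"
    using H by blast
  then show "\<exists>G\<in>{G. G \<subseteq> bounded_functions b \<and> (\<forall>\<phi>\<in>Loc b id_plus. \<exists>f\<in>G. antilocalises \<phi> f)}. |G| \<le>o |H|"
    using card_of_refl ordIso_imp_ordLeq by blast
qed

text \<open>Avoiding the slalom of segments \<open>{..f \<alpha>}\<close> forces values above
  \<open>f\<close>. Conversely, regularity gives a function strictly above a slalom, and whatever
  eventually dominates it avoids the slalom.\<close>

lemma antilocalising_iff_dominating:
  assumes b: "b \<in> R_plus" and G: "G \<subseteq> bounded_functions b"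
  shows "(\<forall>\<phi>\<in>Loc b b. \<exists>f\<in>G. antilocalises \<phi> f) \<longleftrightarrow> (\<forall>f\<in>bounded_functions b. \<exists>g\<in>G. f \<le>* g)"
proof
  assume anti: "\<forall>\<phi>\<in>Loc b b. \<exists>f\<in>G. antilocalises \<phi> f"
  show "\<forall>f\<in>bounded_functions b. \<exists>g\<in>G. f \<le>* g"
  proof
    fix f assume f: "f \<in> bounded_functions b"
    have "|{..f \<alpha>}| <o |{..<b \<alpha>}|" for \<alpha>
    proof -
      have reg: "infinite_regular_cardinal {..<b \<alpha>}" and lt: "f \<alpha> < b \<alpha>"
        using b f by (auto simp: R_plus_def bounded_functions_def)
      have co: "|{..<b \<alpha>}| =o ordrel {..<b \<alpha>}"
        using reg card_of_ordIso_ordrel by (auto simp only: infinite_regular_cardinal_def)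
      \<comment> \<open>With \<open>y\<close> strictly in between, \<open>{..f \<alpha>}\<close>
        sits in a proper initial segment of a cardinal and is smaller than it.\<close>
      obtain y where y: "y < b \<alpha>" "f \<alpha> < y"
        using R_plus_bounded[OF b, of "{f \<alpha>}" \<alpha>] lt reg
          finite_ordLess_infinite[OF card_of_Well_order card_of_Well_order, of "{f \<alpha>}" "{..<b \<alpha>}"]
        by (auto simp: infinite_regular_cardinal_def Field_card_of)
      have "|underS (ordrel {..<b \<alpha>}) y| <o ordrel {..<b \<alpha>}"
        using reg y by (intro card_of_underS) (auto simp: infinite_regular_cardinal_def is_cardinal_def)
      moreover have "{..f \<alpha>} \<subseteq> underS (ordrel {..<b \<alpha>}) y"
        using y by (auto simp: underS_def ordrel_def)
      ultimately have "|{..f \<alpha>}| <o ordrel {..<b \<alpha>}"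
        using card_of_mono1 ordLeq_ordLess_trans by blast
      then show ?thesis using co ordLess_ordIso_trans ordIso_symmetric by blast
    qed
    moreover have "{..f \<alpha>} \<subseteq> {..<b \<alpha>}" for \<alpha>
      using f by (auto simp: bounded_functions_def intro: le_less_trans)
    ultimately have "(\<lambda>\<alpha>. {..f \<alpha>}) \<in> Loc b b" by (simp add: Loc_def)
    then obtain g where g: "g \<in> G" "antilocalises (\<lambda>\<alpha>. {..f \<alpha>}) g" using anti by blast
    then have "f \<le>* g"
      unfolding antilocalises_def le_star_def atMost_iff by (meson linear)
    then show "\<exists>g\<in>G. f \<le>* g" using g(1) by blast
  qed
next
  assume dom: "\<forall>f\<in>bounded_functions b. \<exists>g\<in>G. f \<le>* g"
  show "\<forall>\<phi>\<in>Loc b b. \<exists>f\<in>G. antilocalises \<phi> f"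
  proof
    fix \<phi> assume \<phi>: "\<phi> \<in> Loc b b"
    have "\<exists>x<b \<alpha>. \<forall>a\<in>\<phi> \<alpha>. a < x" for \<alpha>
      by (rule R_plus_bounded[OF b]) (use \<phi> in \<open>auto simp: Loc_def\<close>)
    then have "\<exists>f. \<forall>\<alpha>. f \<alpha> < b \<alpha> \<and> (\<forall>a\<in>\<phi> \<alpha>. a < f \<alpha>)" by (intro choice allI)
    then obtain f where f: "\<And>\<alpha>. f \<alpha> < b \<alpha>" "\<And>\<alpha> a. a \<in> \<phi> \<alpha> \<Longrightarrow> a < f \<alpha>" by blast
    then have "f \<in> bounded_functions b" by (simp add: bounded_functions_def)
    then obtain g where g: "g \<in> G" "f \<le>* g" using dom by blast
    then obtain \<alpha> where "\<And>\<beta>. \<beta> \<ge> \<alpha> \<Longrightarrow> f \<beta> \<le> g \<beta>" by (auto simp: le_star_def)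
    then have "antilocalises \<phi> g" using f(2) unfolding antilocalises_def by (meson not_le)
    then show "\<exists>f\<in>G. antilocalises \<phi> f" using g(1) by blast
  qed
qed

lemma d_antiloc_eq_d_le_star:
  assumes "b \<in> R_plus"
  shows "d_antiloc b b = d_le_star (bounded_functions b)"
proof -
  have "{G. G \<subseteq> bounded_functions b \<and> (\<forall>\<phi>\<in>Loc b b. \<exists>f\<in>G. antilocalises \<phi> f)} =
    {G. G \<subseteq> bounded_functions b \<and> (\<forall>f\<in>bounded_functions b. \<exists>g\<in>G. f \<le>* g)}"
    using antilocalising_iff_dominating[OF assms] by blast
  then show ?thesis by (simp only: d_antiloc_def d_le_star_def)
qed

section \<open>Guessing by diamond and the first inequality\<close>

lemma stationary_mono: "stationary S \<Longrightarrow> S \<subseteq> T \<Longrightarrow> stationary T"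
  unfolding stationary_def by blast

text \<open>Functions are coded by sets of codes of pairs in the graph. At closure points of the map
  sending \<open>\<xi>\<close> to \<open>p (\<xi>, g \<xi>)\<close> the restriction of
  \<open>g\<close> is coded below the point, so a correct guess of the set determines it.\<close>

lemma diamond_functions:
  assumes inacc: "strongly_inaccessible TYPE('k::wellorder)" and "diamond TYPE('k)"
  shows "\<exists>a :: 'k \<Rightarrow> 'k \<Rightarrow> 'k. \<forall>g. stationary {\<alpha>. \<forall>\<beta><\<alpha>. a \<alpha> \<beta> = g \<beta>}"
proof -
  have "|UNIV \<times> UNIV :: ('k \<times> 'k) set| \<le>o |UNIV :: 'k set|"
    using card_of_Times_same_infinite[OF infinite_UNIV[OF inacc]] ordIso_imp_ordLeq by blast
  then obtain p :: "'k \<times> 'k \<Rightarrow> 'k" where p: "inj p"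
    using card_of_ordLeq[of "UNIV :: ('k \<times> 'k) set" "UNIV :: 'k set"] by auto
  obtain A :: "'k \<Rightarrow> 'k set" where A: "\<And>X. stationary {\<alpha>. X \<inter> {..<\<alpha>} = A \<alpha>}"
    using assms(2) unfolding diamond_def by blast
  \<comment> \<open>Arbitrary where the guessed set is not a graph; only correct guesses
    matter.\<close>
  define a where "a \<alpha> \<beta> = (THE y. p (\<beta>, y) \<in> A \<alpha>)" for \<alpha> \<beta>
  have "stationary {\<alpha>. \<forall>\<beta><\<alpha>. a \<alpha> \<beta> = g \<beta>}" for g
  proof -
    let ?X = "range (\<lambda>\<beta>. p (\<beta>, g \<beta>))"
    let ?S = "{\<alpha>. ?X \<inter> {..<\<alpha>} = A \<alpha>} \<inter> {\<delta>. \<forall>\<xi><\<delta>. p (\<xi>, g \<xi>) < \<delta>}"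
    have "stationary ?S"
      by (intro stationary_Int_club[OF inacc] A club_closure_points[OF inacc])
    moreover have "a \<alpha> \<beta> = g \<beta>" if "\<alpha> \<in> ?S" "\<beta> < \<alpha>" for \<alpha> \<beta>
    proof -
      have A: "A \<alpha> = ?X \<inter> {..<\<alpha>}" using that(1) by blast
      have "p (\<beta>, g \<beta>) \<in> A \<alpha>" using that unfolding A by blast
      moreover have "y = g \<beta>" if "p (\<beta>, y) \<in> A \<alpha>" for y
        using that p unfolding A by (auto dest: injD)
      ultimately show ?thesis unfolding a_def by (rule the_equality)
    qed
    then have "?S \<subseteq> {\<alpha>. \<forall>\<beta><\<alpha>. a \<alpha> \<beta> = g \<beta>}" by blast
    ultimately show ?thesis by (rule stationary_mono)
  qed
  then show ?thesis by blast
qed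

lemma not_mahlo_club:
  assumes "strongly_inaccessible TYPE('k::wellorder)" "\<not> mahlo TYPE('k)"
  shows "\<exists>C :: 'k set. club C \<and> (\<forall>\<mu>\<in>C. \<not> infinite_regular_cardinal {..<\<mu>})"
  using assms unfolding mahlo_def stationary_def by blast

text \<open>A countably infinite set is bounded by regularity and uncountability, and its bound has
  infinitely many predecessors. This supplies the base \<open>w\<close>.\<close>

lemma infinite_segment_exists:
  assumes "strongly_inaccessible TYPE('k::wellorder)"
  shows "\<exists>w :: 'k. infinite {..<w}"
proof (rule ccontr)
  assume fin: "\<nexists>w :: 'k. infinite {..<w}"
  obtain d :: "nat \<Rightarrow> 'k" where d: "inj d"
    using infinite_countable_subset[OF infinite_UNIV[OF assms]] by blast
  have "|range d| \<le>o natLeq"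
    using card_of_image card_of_nat ordLeq_ordIso_trans by blast
  then have "|range d| <o |UNIV :: 'k set|"
    using assms unfolding strongly_inaccessible_def using ordLeq_ordLess_trans by blast
  then obtain x where "\<forall>y\<in>range d. y < x" using small_bounded[OF assms] by blast
  then have "range d \<subseteq> {..<x}" by auto
  then have "finite (range d)" using fin finite_subset by blast
  then show False using d finite_imageD infinite_UNIV_nat by blast
qed

text \<open>At most \<open>|max w \<gamma>|\<close> fibres, each of at most that size, have a union
  small enough to be bounded. So large points of \<open>D\<close> have large values.\<close>

lemma thin_preimage_bounded:
  fixes D :: "'k::wellorder set"
  assumes inacc: "strongly_inaccessible TYPE('k)" and w: "infinite {..<w}" and r: "thin w D r"
  shows "\<exists>x. \<forall>\<alpha>\<in>D. r \<alpha> < \<gamma> \<longrightarrow> \<alpha> < x"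
proof -
  let ?v = "max w \<gamma>"
  have inf: "infinite {..<?v}" by (rule infinite_segment_mono[OF w]) simp
  have fibre: "|{\<alpha>\<in>D. r \<alpha> = \<beta>}| \<le>o |{..<?v}|" if "\<beta> \<in> {w..<\<gamma>}" for \<beta>
  proof -
    have "|{\<alpha>\<in>D. r \<alpha> = \<beta>}| \<le>o |{..<\<beta>}|" using r that by (simp add: thin_def)
    moreover have "|{..<\<beta>}| \<le>o |{..<?v}|" using that by (intro card_of_mono1) auto
    ultimately show ?thesis by (rule ordLeq_transitive)
  qed
  have "|{w..<\<gamma>}| \<le>o |{..<?v}|" by (intro card_of_mono1) auto
  then have "|\<Union>\<beta>\<in>{w..<\<gamma>}. {\<alpha>\<in>D. r \<alpha> = \<beta>}| \<le>o |{..<?v}|"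
    by (rule card_of_UNION_ordLeq_infinite[OF inf]) (intro ballI fibre)
  then have "|\<Union>\<beta>\<in>{w..<\<gamma>}. {\<alpha>\<in>D. r \<alpha> = \<beta>}| <o |UNIV :: 'k set|"
    by (rule ordLeq_ordLess_trans[OF _ card_of_segment[OF inacc]])
  from small_bounded[OF inacc this]
  obtain x where x: "\<forall>\<alpha>\<in>(\<Union>\<beta>\<in>{w..<\<gamma>}. {\<alpha>\<in>D. r \<alpha> = \<beta>}). \<alpha> < x" by blast
  have "\<alpha> < x" if "\<alpha> \<in> D" "r \<alpha> < \<gamma>" for \<alpha>
    using x that r by (auto simp: thin_def)
  then show ?thesis by blast
qed

text \<open>The order of quantifiers matters: \<open>next_guess\<close> is fixed before
  \<open>f\<close>, so it maps whole families, while \<open>\<phi>\<close> may depend on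
  \<open>f\<close>.\<close>

lemma next_guess_dominates:
  fixes b :: "'k::wellorder \<Rightarrow> 'k"
  assumes inacc: "strongly_inaccessible TYPE('k)" and "\<not> mahlo TYPE('k)" "diamond TYPE('k)"
    and b: "b \<in> R_plus"
  shows "\<exists>next_guess :: ('k \<Rightarrow> 'k) \<Rightarrow> 'k \<Rightarrow> 'k. \<forall>f. \<exists>\<phi>\<in>Loc b id_plus. \<forall>g\<in>bounded_functions b.
    antilocalises \<phi> g \<longrightarrow> f \<le>* next_guess g"
proof -
  obtain C :: "'k set" where C: "club C" "\<And>\<mu>. \<mu> \<in> C \<Longrightarrow> \<not> infinite_regular_cardinal {..<\<mu>}"
    using not_mahlo_club assms by blast
  obtain w :: 'k where w: "infinite {..<w}" using infinite_segment_exists[OF inacc] by blast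
  obtain a :: "'k \<Rightarrow> 'k \<Rightarrow> 'k" where a: "\<And>g. stationary {\<alpha>. \<forall>\<beta><\<alpha>. a \<alpha> \<beta> = g \<beta>}"
    using diamond_functions assms by blast
  \<comment> \<open>Restricting to \<open>C\<close> above \<open>w\<close> puts every point of
    \<open>T g\<close> outside \<open>E\<close> into the domain \<open>D\<close> of
    \<open>r\<close>.\<close>
  define T where "T g = {\<alpha>. \<forall>\<beta><\<alpha>. a \<alpha> \<beta> = g \<beta>} \<inter> (C \<inter> {w<..})" for g
  have "\<exists>\<alpha>\<in>T g. \<xi> < \<alpha>" for g \<xi>
    unfolding T_def
    by (intro stationary_unbounded[OF inacc] stationary_Int_club[OF inacc] a club_Int[OF inacc] C(1)
        club_greaterThan[OF inacc])
  \<comment> \<open>An arbitrary choice of an element above \<open>\<xi>\<close> serves as the next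
    element.\<close>
  then obtain N where N: "\<And>g \<xi>. N g \<xi> \<in> T g" "\<And>g \<xi>. \<xi> < N g \<xi>" by metis
  have "\<exists>\<phi>\<in>Loc b id_plus. \<forall>g\<in>bounded_functions b. antilocalises \<phi> g \<longrightarrow> f \<le>* N g" for f
  proof -
    define E where "E = {\<delta>. \<forall>\<xi><\<delta>. f \<xi> < \<delta>}"
    define D where "D = C \<inter> {w<..} - E"
    obtain r where r: "thin w D r"
      using thin_nonstationary[OF w C(1) club_closure_points[OF inacc] C(2)]
      unfolding D_def E_def by blast
    \<comment> \<open>Guesses may exceed \<open>b\<close>; cutting them off loses no value of a
      \<open>g\<close> bounded by \<open>b\<close>.\<close>
    define \<phi> where "\<phi> \<beta> = (\<lambda>\<alpha>. a \<alpha> \<beta>) ` {\<alpha>\<in>D. r \<alpha> = \<beta>} \<inter> {..<b \<beta>}" for \<beta>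
    have "|\<phi> \<beta>| <o |{..<id_plus \<beta>}|" for \<beta>
    proof -
      have "|{\<alpha>\<in>D. r \<alpha> = \<beta>}| \<le>o |{..<\<beta>}|"
      proof (cases "w \<le> \<beta>")
        case False
        then have "{\<alpha>\<in>D. r \<alpha> = \<beta>} = {}" using r by (auto simp: thin_def)
        then show ?thesis by (simp only: card_of_empty)
      qed (use r in \<open>simp add: thin_def\<close>)
      moreover have "|(\<lambda>\<alpha>. a \<alpha> \<beta>) ` {\<alpha>\<in>D. r \<alpha> = \<beta>}| \<le>o |{\<alpha>\<in>D. r \<alpha> = \<beta>}|"
        by (rule card_of_image)
      moreover have "|\<phi> \<beta>| \<le>o |(\<lambda>\<alpha>. a \<alpha> \<beta>) ` {\<alpha>\<in>D. r \<alpha> = \<beta>}|"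
        unfolding \<phi>_def by (rule card_of_mono1) blast
      ultimately have "|\<phi> \<beta>| \<le>o |{..<\<beta>}|" by (blast intro: ordLeq_transitive)
      then show ?thesis by (rule ordLeq_ordLess_trans[OF _ id_plus_R_plus(2)[OF b]])
    qed
    moreover have "\<phi> \<beta> \<subseteq> {..<b \<beta>}" for \<beta> by (simp add: \<phi>_def)
    ultimately have "\<phi> \<in> Loc b id_plus" by (simp add: Loc_def)
    moreover have "f \<le>* N g" if g: "g \<in> bounded_functions b" and anti: "antilocalises \<phi> g" for g
    proof -
      obtain \<gamma> where \<gamma>: "\<And>\<beta>. \<gamma> \<le> \<beta> \<Longrightarrow> g \<beta> \<notin> \<phi> \<beta>"
        using anti by (auto simp: antilocalises_def)
      \<comment> \<open>The guess at \<open>\<alpha>\<close> is correct at the smaller point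
        \<open>r \<alpha>\<close>, so the slalom catches \<open>g\<close> there, which is impossible
        from \<open>\<gamma>\<close> on.\<close>
      have "r \<alpha> < \<gamma>" if "\<alpha> \<in> T g - E" for \<alpha>
      proof (rule ccontr)
        assume "\<not> r \<alpha> < \<gamma>"
        then have "g (r \<alpha>) \<notin> \<phi> (r \<alpha>)" using \<gamma> by (simp add: not_less)
        moreover have D: "\<alpha> \<in> D" using that by (auto simp: T_def D_def)
        then have "r \<alpha> < \<alpha>" using r by (simp add: thin_def)
        then have "a \<alpha> (r \<alpha>) = g (r \<alpha>)" using that by (auto simp: T_def)
        then have "g (r \<alpha>) \<in> (\<lambda>\<alpha>'. a \<alpha>' (r \<alpha>)) ` {\<alpha>'\<in>D. r \<alpha>' = r \<alpha>}"
          using D by (intro image_eqI[of _ _ \<alpha>]) auto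
        moreover have "g (r \<alpha>) < b (r \<alpha>)" using g by (auto simp: bounded_functions_def)
        ultimately show False by (simp add: \<phi>_def)
      qed
      moreover obtain x where x: "\<And>\<alpha>. \<alpha> \<in> D \<Longrightarrow> r \<alpha> < \<gamma> \<Longrightarrow> \<alpha> < x"
        using thin_preimage_bounded[OF inacc w r] by blast
      moreover have "T g - E \<subseteq> D" by (auto simp: T_def D_def)
      ultimately have TE: "\<alpha> < x" if "\<alpha> \<in> T g - E" for \<alpha> using that by blast
      \<comment> \<open>Beyond \<open>x\<close> all points of \<open>T g\<close> are closure points
        of \<open>f\<close>.\<close>
      have "f \<xi> \<le> N g \<xi>" if "x \<le> \<xi>" for \<xi>
      proof -
        have "x < N g \<xi>" using that N(2)[of \<xi> g] by (rule le_less_trans)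
        then have "N g \<xi> \<in> E" using TE[of "N g \<xi>"] N(1)[of g \<xi>] by (meson DiffI order.asym)
        then show ?thesis using N(2)[of \<xi> g] by (auto simp: E_def less_imp_le)
      qed
      then show ?thesis by (auto simp: le_star_def)
    qed
    ultimately show ?thesis by blast
  qed
  then show ?thesis by blast
qed

text \<open>The image of an antilocalising family under the map just constructed is dominating and
  no larger.\<close>

lemma d_le_star_le_d_antiloc:
  fixes b :: "'k::wellorder \<Rightarrow> 'k"
  assumes "strongly_inaccessible TYPE('k)" "\<not> mahlo TYPE('k)" "diamond TYPE('k)" "b \<in> R_plus"
  shows "d_le_star (UNIV :: ('k \<Rightarrow> 'k) set) \<le>o d_antiloc b id_plus"
  unfolding d_le_star_def d_antiloc_def
proof (rule least_size_mono)
  show "bounded_functions b \<in> {G. G \<subseteq> bounded_functions b \<and> (\<forall>\<phi>\<in>Loc b id_plus. \<exists>f\<in>G. antilocalises \<phi> f)}"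
    by (rule bounded_functions_antilocalising) (rule id_plus_R_plus[OF assms(4)])
next
  fix H assume H: "H \<in> {G. G \<subseteq> bounded_functions b \<and> (\<forall>\<phi>\<in>Loc b id_plus. \<exists>f\<in>G. antilocalises \<phi> f)}"
  obtain N :: "('k \<Rightarrow> 'k) \<Rightarrow> 'k \<Rightarrow> 'k" where N: "\<And>f. \<exists>\<phi>\<in>Loc b id_plus. \<forall>g\<in>bounded_functions b.
      antilocalises \<phi> g \<longrightarrow> f \<le>* N g"
    using next_guess_dominates[OF assms] by blast
  have "\<exists>g\<in>N ` H. f \<le>* g" for f using N[of f] H by blast
  then have "N ` H \<in> {G. G \<subseteq> UNIV \<and> (\<forall>f\<in>UNIV. \<exists>g\<in>G. f \<le>* g)}" by blast
  with card_of_image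
  show "\<exists>G\<in>{G. G \<subseteq> (UNIV :: ('k \<Rightarrow> 'k) set) \<and> (\<forall>f\<in>UNIV. \<exists>g\<in>G. f \<le>* g)}. |G| \<le>o |H|"
    by (rule bexI)
qed (rule UNIV_dominating)

theorem theorem2p7:
  fixes b :: "'k::wellorder \<Rightarrow> 'k"
  assumes "strongly_inaccessible TYPE('k)"
    and "\<not> mahlo TYPE('k)"
    and "diamond TYPE('k)"
    and "b \<in> R_plus"
  shows "d_le_star (UNIV :: ('k \<Rightarrow> 'k) set) \<le>o d_antiloc b id_plus \<and>
         d_antiloc b id_plus \<le>o d_antiloc b b \<and>
         d_antiloc b b =o d_le_star (bounded_functions b)"
proof -
  \<comment> \<open>The last two cardinals are literally equal; passing to \<open>=o\<close> uses
    reflexivity on well-orders.\<close>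
  have "Card_order (d_antiloc b b)"
    unfolding d_antiloc_def least_size_def by (rule card_of_Card_order)
  then show ?thesis
    using d_le_star_le_d_antiloc[OF assms] d_antiloc_id_plus_le[OF assms(4)]
      d_antiloc_eq_d_le_star[OF assms(4)] by (metis card_order_on_well_order_on ordIso_reflexive)
qed

end
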